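(* Let $k,m\in\mathbb{N}$, $p>0$, $\lambda\in(0,\infty)$ and $a\in[0,1)$, and let $R_4=R^{p,m,k}_{\lambda,a}$ be the minimal positive root in $(0,1)$ of the equation $\Psi_4(r)=0$, where $$\Psi_4(r)=(1+ar^m)^p\big[1+(\lambda a^2-\lambda-1)r^k\big]-(1-r^k)(a+r^m)^p .$$ Let $f(z)=\sum_{j=0}^\infty a_jz^j\in\mathcal{B}$ with $|a_0|=a$, and let $\omega_n\in\mathcal{B}_n$ for $n\ge1$. Then $$C_f(z):=|f(\omega_m(z))|^p+\lambda\Big[B_1(f,|\omega_k(z)|)+A(f_0,|\omega_k(z)|)\Big]\le1\qquad\text{for }0\le|z|=r\le R_4 .$$ The constant $R_4$ cannot be improved: for every $R\in(R_4,1)$ there exist such $f$ (with $|f(0)|=a$) and $\omega_n$ ($n\ge1$) and a point $z$ with $|z|\le R$ such that $C_f(z)>1$.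
   Context: $\mathbb{N}=\{1,2,\dots\}$ and $\mathbb{D}=\{z\in\mathbb{C}:|z|<1\}$. $\mathcal{B}$ is the class of analytic functions $f$ on $\mathbb{D}$ with $\sup_{z\in\mathbb{D}}|f(z)|\le 1$. For $n\in\mathbb{N}$, $\mathcal{B}_n=\{\omega\in\mathcal{B}:\omega(0)=\cdots=\omega^{(n-1)}(0)=0,\ \omega^{(n)}(0)\ne0\}$. For $f(z)=\sum_{n\ge0}a_nz^n\in\mathcal{B}$, $f_0(z)=f(z)-f(0)$ and $0\le\rho<1$, put $$B_1(f,\rho)=\sum_{n=1}^\infty|a_n|\rho^n,\qquad A(f_0,\rho)=\Big(\frac1{1+|a_0|}+\frac{\rho}{1-\rho}\Big)\sum_{n=1}^\infty|a_n|^2\rho^{2n}.$$ *)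

theory Defs
  imports "HOL-Complex_Analysis.Complex_Analysis"
begin

definition unit_disk_class :: "(complex \<Rightarrow> complex) set" (\<open>\<B>\<close>) where
  "\<B> = {f. f analytic_on ball 0 1 \<and> (\<forall>z\<in>ball 0 1. cmod (f z) \<le> 1)}"

definition zero_order_class :: "nat \<Rightarrow> (complex \<Rightarrow> complex) set" where
  "zero_order_class n =
     {\<omega> \<in> \<B>. (\<forall>j<n. (deriv ^^ j) \<omega> 0 = 0) \<and> (deriv ^^ n) \<omega> 0 \<noteq> 0}"

abbreviation tcoeff :: "(complex \<Rightarrow> complex) \<Rightarrow> nat \<Rightarrow> complex" where
  "tcoeff f n \<equiv> fps_nth (fps_expansion f 0) n"

definition B1 :: "(complex \<Rightarrow> complex) \<Rightarrow> real \<Rightarrow> real" where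
  "B1 f \<rho> = (\<Sum>n. cmod (tcoeff f (Suc n)) * \<rho> ^ Suc n)"

(* This is A(f - f(0), \<rho>). The argument is f itself, since the formula also involves
   the coefficient of order 0, which cannot be recovered from f - f(0); the other
   coefficients of f and f - f(0) coincide. *)
definition A_term :: "(complex \<Rightarrow> complex) \<Rightarrow> real \<Rightarrow> real" where
  "A_term f \<rho> = (1 / (1 + cmod (tcoeff f 0)) + \<rho> / (1 - \<rho>)) *
     (\<Sum>n. (cmod (tcoeff f (Suc n)))\<^sup>2 * \<rho> ^ (2 * Suc n))"

definition C_fun ::
  "real \<Rightarrow> real \<Rightarrow> nat \<Rightarrow> nat \<Rightarrow> (complex \<Rightarrow> complex) \<Rightarrow> (nat \<Rightarrow> complex \<Rightarrow> complex) \<Rightarrow> complex \<Rightarrow> real"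
  where
  "C_fun p lam m k f \<omega> z = cmod (f (\<omega> m z)) powr p
     + lam * (B1 f (cmod (\<omega> k z)) + A_term f (cmod (\<omega> k z)))"

definition Psi4 :: "real \<Rightarrow> real \<Rightarrow> real \<Rightarrow> nat \<Rightarrow> nat \<Rightarrow> real \<Rightarrow> real" where
  "Psi4 p lam a m k r =
     (1 + a * r ^ m) powr p * (1 + (lam * a\<^sup>2 - lam - 1) * r ^ k)
     - (1 - r ^ k) * (a + r ^ m) powr p"

definition minimal_root_01 :: "(real \<Rightarrow> real) \<Rightarrow> real \<Rightarrow> bool" where
  "minimal_root_01 \<Psi> R \<longleftrightarrow>
     0 < R \<and> R < 1 \<and> \<Psi> R = 0 \<and> (\<forall>r. 0 < r \<and> r < 1 \<and> \<Psi> r = 0 \<longrightarrow> R \<le> r)"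

end

theory Submission
  imports Defs
begin

text \<open>
  On \<open>0 < r < 1\<close> the function \<open>\<Psi>\<^sub>4\<close> is a positive multiple of \<open>1 - \<Phi>(r)\<close>, where
  \<open>\<Phi>(r) = ((a + r\<^sup>m) / (1 + a r\<^sup>m))\<^sup>p + \<lambda> (1 - a\<^sup>2) r\<^sup>k / (1 - r\<^sup>k)\<close> is strictly increasing, so its root is
  unique. By the Schwarz and Schwarz--Pick lemmas, \<open>C\<^sub>f(z) \<le> \<Phi>(\<bar>z\<bar>)\<close> once
  \<open>B\<^sub>1 + A \<le> (1 - a\<^sup>2) \<rho> / (1 - \<rho>)\<close> is known; the latter is the weighted sum of Carlson's
  inequalities for \<open>\<bar>a\<^sub>2\<^sub>n\<^sub>+\<^sub>1\<bar>\<close> and \<open>\<bar>a\<^sub>2\<^sub>n\<bar>\<close>. These follow by testing the fact that multiplication by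
  \<open>f\<close> is a contraction of \<open>H\<^sup>2\<close>, i.e. that the triangular Toeplitz matrices of the coefficients are
  contractions, on suitable vectors. The functions \<open>f(z) = (z + a) / (1 + a z)\<close> and
  \<open>\<omega>\<^sub>n(z) = z\<^sup>n\<close> give \<open>C\<^sub>f(r) = \<Phi>(r)\<close>.
\<close>

section \<open>The class of bounded functions and its Taylor coefficients\<close>

lemma unit_disk_class_iff:
  "f \<in> \<B> \<longleftrightarrow> f holomorphic_on ball 0 1 \<and> (\<forall>z. cmod z < 1 \<longrightarrow> cmod (f z) \<le> 1)"
  by (auto simp: unit_disk_class_def analytic_on_open)

lemma has_fps_expansion_disk:
  assumes "f holomorphic_on ball 0 R" "0 < R"
  shows "f has_fps_expansion fps_expansion f 0"
  using assms by (intro analytic_at_imp_has_fps_expansion_0)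
    (auto simp: analytic_at intro!: exI[of _ "ball 0 R"])

lemma tcoeff_0: "tcoeff f 0 = f 0"
  by (simp add: fps_expansion_def)

lemma higher_deriv_eq_tcoeff: "(deriv ^^ n) f 0 = fact n * tcoeff f n"
  by (simp add: fps_expansion_def)

section \<open>Integrals over circles and the contraction property of Toeplitz matrices\<close>

text \<open>Cauchy's formula for the derivative of order \<open>n\<close> on the circle of radius
  \<open>r\<close>, multiplied by \<open>r ^ n / (2 * pi * \<i>)\<close>; on the unit circle
  conjugation is inversion.\<close>

lemma Fourier_coefficient_has_integral:
  assumes h: "h holomorphic_on ball 0 R" and r: "0 < r" "r < R"
  shows "((\<lambda>t. h (of_real r * cis (2*pi*t)) * cnj (cis (2*pi*t)) ^ n) has_integral
           tcoeff h n * of_real r ^ n) {0..1}"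
proof -
  have "((\<lambda>u. h u / (u-0) ^ (Suc n)) has_contour_integral
          (2 * pi * \<i>) / fact n * (deriv ^^ n) h 0) (circlepath 0 r)"
    using r by (intro Cauchy_has_contour_integral_higher_derivative_circlepath
        holomorphic_on_imp_continuous_on holomorphic_on_subset[OF h]) auto
  hence "((\<lambda>t. h (circlepath 0 r t) / (circlepath 0 r t) ^ Suc n *
            vector_derivative (circlepath 0 r) (at t within {0..1})) has_integral
          2 * pi * \<i> * tcoeff h n) {0..1}"
    by (simp add: has_contour_integral_def higher_deriv_eq_tcoeff mult.assoc)
  hence "((\<lambda>t. of_real r ^ n / (2 * pi * \<i>) *
           (h (circlepath 0 r t) / (circlepath 0 r t) ^ Suc n *
            vector_derivative (circlepath 0 r) (at t within {0..1}))) has_integral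
          of_real r ^ n / (2 * pi * \<i>) * (2 * pi * \<i> * tcoeff h n)) {0..1}"
    by (rule has_integral_mult_right)
  also have "of_real r ^ n / (2 * pi * \<i>) * (2 * pi * \<i> * tcoeff h n) = tcoeff h n * of_real r ^ n"
    by (simp add: field_simps)
  finally show ?thesis
  proof (rule has_integral_eq[rotated])
    fix t :: real assume t: "t \<in> {0..1}"
    have cp: "circlepath 0 r t = of_real r * cis (2*pi*t)"
      by (simp add: circlepath cis_conv_exp mult_ac)
    have vd: "vector_derivative (circlepath 0 r) (at t within {0..1}) =
        2 * pi * \<i> * (of_real r * cis (2*pi*t))"
      using t by (simp add: vector_derivative_circlepath01 cis_conv_exp mult_ac)
    have c: "cnj (cis (2*pi*t)) ^ n = 1 / cis (2*pi*t) ^ n"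
      by (simp add: cis_cnj field_simps flip: power_mult_distrib cis_inverse)
    show "of_real r ^ n / (2 * pi * \<i>) *
           (h (circlepath 0 r t) / (circlepath 0 r t) ^ Suc n *
            vector_derivative (circlepath 0 r) (at t within {0..1}))
          = h (of_real r * cis (2*pi*t)) * cnj (cis (2*pi*t)) ^ n"
      unfolding c vd cp using r by (simp add: field_simps)
  qed
qed

lemma has_fps_expansion_finite_sum:
  fixes g :: "nat \<Rightarrow> complex"
  shows "(\<lambda>z. \<Sum>i\<le>N. g i * z ^ i) has_fps_expansion (\<Sum>i\<le>N. fps_const (g i) * fps_X ^ i)"
  by (intro fps_expansion_intros)

lemma fps_nth_finite_sum:
  fixes g :: "nat \<Rightarrow> complex"
  shows "fps_nth (\<Sum>i\<le>N. fps_const (g i) * fps_X ^ i) n = (if n \<le> N then g n else 0)"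
  by (simp add: fps_sum_nth fps_X_power_nth if_distrib sum.delta cong: if_cong)

text \<open>Pairing with a polynomial involves finitely many Fourier coefficients, so Parseval's
  identity is available here without interchanging a series and an integral.\<close>

lemma circle_inner_product_has_integral:
  fixes q :: "nat \<Rightarrow> complex"
  assumes h: "h holomorphic_on ball 0 R" and r: "0 < r" "r < R"
  shows "((\<lambda>t. h (of_real r * cis (2*pi*t)) * cnj (\<Sum>i\<le>N. q i * (of_real r * cis (2*pi*t)) ^ i))
           has_integral (\<Sum>i\<le>N. tcoeff h i * cnj (q i) * of_real (r ^ (2*i)))) {0..1}"
proof -
  have "((\<lambda>t. \<Sum>i\<le>N. (cnj (q i) * of_real r ^ i) *
           (h (of_real r * cis (2*pi*t)) * cnj (cis (2*pi*t)) ^ i))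
         has_integral (\<Sum>i\<le>N. (cnj (q i) * of_real r ^ i) * (tcoeff h i * of_real r ^ i))) {0..1}"
    by (intro has_integral_sum has_integral_mult_right Fourier_coefficient_has_integral[OF h r]) auto
  thus ?thesis
    by (simp add: sum_distrib_left power_mult_distrib mult_ac power_mult power2_eq_square)
qed

lemma circle_norm_has_integral:
  fixes q :: "nat \<Rightarrow> complex"
  assumes r: "0 < r"
  shows "((\<lambda>t. (cmod (\<Sum>i\<le>N. q i * (of_real r * cis (2*pi*t)) ^ i))\<^sup>2)
           has_integral (\<Sum>i\<le>N. (cmod (q i))\<^sup>2 * r ^ (2*i))) {0..1}"
proof -
  let ?Q = "\<lambda>z. \<Sum>i\<le>N. q i * z ^ i"
  have "((\<lambda>t. ?Q (of_real r * cis (2*pi*t)) * cnj (?Q (of_real r * cis (2*pi*t)))) has_integral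
     (\<Sum>i\<le>N. tcoeff ?Q i * cnj (q i) * of_real (r ^ (2*i)))) {0..1}"
    using r by (intro circle_inner_product_has_integral[of _ "r+1"] holomorphic_intros) auto
  also have "(\<Sum>i\<le>N. tcoeff ?Q i * cnj (q i) * of_real (r ^ (2*i))) =
      of_real (\<Sum>i\<le>N. (cmod (q i))\<^sup>2 * r ^ (2*i))"
    by (auto simp: fps_expansion_eqI[OF has_fps_expansion_finite_sum] fps_nth_finite_sum
        complex_norm_square[symmetric] intro!: sum.cong)
  finally show ?thesis
    unfolding complex_norm_square[symmetric] by (auto dest: has_integral_Re)
qed

text \<open>The entries \<open>c i\<close> of the image vector are the first coefficients of
  \<open>G * f\<close>. On the circle of radius \<open>r\<close>, pairing \<open>G * f\<close> with
  its own truncation P yields the squared norm of P. Since \<open>cmod (f z) \<le> 1\<close>, this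
  pairing is at most half the sum of the squared norms of G and P; the half belonging to P is
  absorbed on the left. Letting \<open>r\<close> tend to 1 removes the weights.\<close>

lemma Toeplitz_contraction:
  fixes g :: "nat \<Rightarrow> complex"
  assumes f: "f \<in> \<B>"
  shows "(\<Sum>i\<le>N. (cmod (\<Sum>j\<le>i. tcoeff f (i - j) * g j))\<^sup>2) \<le> (\<Sum>i\<le>N. (cmod (g i))\<^sup>2)"
proof -
  define G where "G = (\<lambda>z. \<Sum>i\<le>N. g i * z ^ i)"
  define c where "c i = (\<Sum>j\<le>i. tcoeff f (i - j) * g j)" for i
  have hf: "f holomorphic_on ball 0 1" and bf: "\<And>z. cmod z < 1 \<Longrightarrow> cmod (f z) \<le> 1"
    using f by (auto simp: unit_disk_class_iff)
  have c: "tcoeff (\<lambda>z. G z * f z) i = c i" if "i \<le> N" for i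
  proof -
    have "tcoeff (\<lambda>z. G z * f z) i =
        fps_nth ((\<Sum>i\<le>N. fps_const (g i) * fps_X ^ i) * fps_expansion f 0) i"
      unfolding G_def
      by (subst fps_expansion_eqI[OF has_fps_expansion_mult[OF has_fps_expansion_finite_sum
              has_fps_expansion_disk[OF hf zero_less_one]]]) (rule refl)
    also have "\<dots> = c i"
      unfolding fps_mult_nth fps_nth_finite_sum c_def atLeast0AtMost
      using that by (intro sum.cong) auto
    finally show ?thesis .
  qed
  have le: "(\<Sum>i\<le>N. (cmod (c i))\<^sup>2 * r ^ (2*i)) \<le> (\<Sum>i\<le>N. (cmod (g i))\<^sup>2 * r ^ (2*i))"
    if r: "0 < r" "r < 1" for r
  proof -
    let ?e = "\<lambda>t. of_real r * cis (2*pi*t) :: complex"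
    let ?P = "\<lambda>z. \<Sum>i\<le>N. c i * z ^ i"
    have "((\<lambda>t. (G (?e t) * f (?e t)) * cnj (?P (?e t))) has_integral
       (\<Sum>i\<le>N. tcoeff (\<lambda>z. G z * f z) i * cnj (c i) * of_real (r ^ (2*i)))) {0..1}"
      using r unfolding G_def
      by (intro circle_inner_product_has_integral[of _ 1] holomorphic_intros hf) auto
    also have "(\<Sum>i\<le>N. tcoeff (\<lambda>z. G z * f z) i * cnj (c i) * of_real (r ^ (2*i))) =
       of_real (\<Sum>i\<le>N. (cmod (c i))\<^sup>2 * r ^ (2*i))"
      by (auto simp: c complex_norm_square[symmetric] intro!: sum.cong)
    finally have "((\<lambda>t. (G (?e t) * f (?e t)) * cnj (?P (?e t))) has_integral
       of_real (\<Sum>i\<le>N. (cmod (c i))\<^sup>2 * r ^ (2*i))) {0..1}" .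
    from has_integral_Re[OF this] have 1: "((\<lambda>t. Re ((G (?e t) * f (?e t)) * cnj (?P (?e t)))) has_integral
       (\<Sum>i\<le>N. (cmod (c i))\<^sup>2 * r ^ (2*i))) {0..1}"
      by (simp only: Re_complex_of_real)
    have 2: "((\<lambda>t. 1/2 * ((cmod (G (?e t)))\<^sup>2 + (cmod (?P (?e t)))\<^sup>2)) has_integral
       1/2 * ((\<Sum>i\<le>N. (cmod (g i))\<^sup>2 * r ^ (2*i)) + (\<Sum>i\<le>N. (cmod (c i))\<^sup>2 * r ^ (2*i)))) {0..1}"
      unfolding G_def
      by (intro has_integral_mult_right has_integral_add circle_norm_has_integral r)
    have "Re ((G z * f z) * cnj w) \<le> 1/2 * ((cmod (G z))\<^sup>2 + (cmod w)\<^sup>2)" if "cmod z = r" for z w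
    proof -
      have "Re ((G z * f z) * cnj w) \<le> cmod (G z) * cmod (f z) * cmod w"
        using complex_Re_le_cmod[of "(G z * f z) * cnj w"] by (simp add: norm_mult)
      also have "\<dots> \<le> cmod (G z) * 1 * cmod w"
        using bf[of z] that r by (intro mult_left_mono mult_right_mono) auto
      also have "\<dots> \<le> 1/2 * ((cmod (G z))\<^sup>2 + (cmod w)\<^sup>2)"
        using sum_squares_bound[of "cmod (G z)" "cmod w"] by simp
      finally show ?thesis .
    qed
    from has_integral_le[OF 1 2 this] r show ?thesis
      by (simp add: norm_mult)
  qed
  have "eventually (\<lambda>r. (\<Sum>i\<le>N. (cmod (c i))\<^sup>2 * r ^ (2*i)) \<le> (\<Sum>i\<le>N. (cmod (g i))\<^sup>2 * r ^ (2*i)))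
          (at_left (1::real))"
    by (rule eventually_mono[OF eventually_at_left_real[OF zero_less_one]]) (auto intro: le)
  moreover have "((\<lambda>r. \<Sum>i\<le>N. (cmod (u i))\<^sup>2 * r ^ (2*i)) \<longlongrightarrow> (\<Sum>i\<le>N. (cmod (u i))\<^sup>2 * 1 ^ (2*i)))
          (at_left (1::real))" for u :: "nat \<Rightarrow> complex"
    by (intro tendsto_intros)
  ultimately have "(\<Sum>i\<le>N. (cmod (c i))\<^sup>2 * 1 ^ (2*i)) \<le> (\<Sum>i\<le>N. (cmod (g i))\<^sup>2 * 1 ^ (2*i))"
    by (intro tendsto_le[of "at_left (1::real)"]) auto
  thus ?thesis by (simp add: c_def)
qed

section \<open>The Schwarz lemma for zeros of higher order and the Schwarz-Pick bound\<close>

text \<open>Division by z stays inside the class and shifts the coefficients by one, which makes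
  induction on the order of the zero possible.\<close>

lemma disk_divide_X:
  assumes f: "f \<in> \<B>" and 0: "f 0 = 0"
  obtains h where "h \<in> \<B>" "\<And>z. cmod z < 1 \<Longrightarrow> f z = z * h z" "\<And>j. tcoeff h j = tcoeff f (Suc j)"
proof -
  have hf: "f holomorphic_on ball 0 1" and bf: "\<And>z. cmod z < 1 \<Longrightarrow> cmod (f z) \<le> 1"
    using f by (auto simp: unit_disk_class_iff)
  obtain h where h: "h holomorphic_on ball 0 1" and fh: "\<And>z. cmod z < 1 \<Longrightarrow> f z = z * h z"
    using Schwarz3[OF hf 0] by blast
  have bh: "cmod (h z) \<le> 1" if z: "cmod z < 1" for z
  proof (rule field_le_mult_one_interval)
    \<comment> \<open>Outside the circle of radius \<open>s\<close> the bound is read off from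
      \<open>f z = z * h z\<close>; inside it the maximum principle carries over the bound
      \<open>1 / s\<close> from the circle.\<close>
    fix s :: real assume s: "0 < s" "s < 1"
    show "s * cmod (h z) \<le> 1"
    proof (cases "s \<le> cmod z")
      case True
      have "s * cmod (h z) \<le> cmod z * cmod (h z)"
        using True by (rule mult_right_mono) auto
      also have "\<dots> \<le> 1"
        using bf[OF z] fh[OF z] by (simp add: norm_mult)
      finally show ?thesis .
    next
      case False
      have "cmod (h z) \<le> 1 / s"
      proof (rule maximum_modulus_frontier[where f = h and \<xi> = z and S = "cball 0 s"])
        fix w :: complex assume "w \<in> frontier (cball 0 s)"
        hence w: "cmod w = s" using s by (simp add: frontier_cball)
        thus "cmod (h w) \<le> 1 / s"
          using bf[of w] fh[of w] s by (simp add: norm_mult field_simps)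
      qed (use s False in \<open>auto intro!: holomorphic_on_imp_continuous_on holomorphic_on_subset[OF h]\<close>)
      thus ?thesis using s by (simp add: field_simps)
    qed
  qed
  have "(\<lambda>z. z * h z) has_fps_expansion fps_X * fps_expansion h 0"
    by (intro fps_expansion_intros has_fps_expansion_disk[OF h]) auto
  \<comment> \<open>The factorisation is known on the disk only; agreement near 0 suffices for equal
    expansions.\<close>
  moreover have "eventually (\<lambda>z. z * h z = f z) (nhds 0)"
    using eventually_nhds_in_open[of "ball 0 (1::real)" "0::complex"]
    by (auto elim!: eventually_mono simp: fh)
  ultimately have "f has_fps_expansion fps_X * fps_expansion h 0"
    using has_fps_expansion_cong[of "\<lambda>z. z * h z" f] by simp
  hence "tcoeff f (Suc j) = tcoeff h j" for j
    by (simp add: fps_expansion_eqI)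
  with that[of h] h bh fh show ?thesis
    by (auto simp: unit_disk_class_iff)
qed

lemma Schwarz_zero_order:
  assumes "f \<in> \<B>" "\<And>j. j < n \<Longrightarrow> tcoeff f j = 0" "cmod z < 1"
  shows "cmod (f z) \<le> cmod z ^ n"
  using assms(1,2)
proof (induction n arbitrary: f)
  case 0
  thus ?case using assms(3) by (auto simp: unit_disk_class_iff)
next
  case (Suc n)
  have "f 0 = 0" using Suc.prems(2)[of 0] by (simp add: tcoeff_0)
  then obtain h where h: "h \<in> \<B>" "\<And>z. cmod z < 1 \<Longrightarrow> f z = z * h z"
    "\<And>j. tcoeff h j = tcoeff f (Suc j)"
    using disk_divide_X[OF Suc.prems(1)] by metis
  have "cmod (h z) \<le> cmod z ^ n"
    using Suc.prems(2) by (intro Suc.IH h) (auto simp: h(3))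
  thus ?case using h(2)[OF assms(3)] by (simp add: norm_mult mult_left_mono)
qed

lemma zero_order_class_norm_le:
  assumes "\<omega> \<in> zero_order_class n" "cmod z < 1"
  shows "cmod (\<omega> z) \<le> cmod z ^ n"
  using assms by (intro Schwarz_zero_order) (auto simp: zero_order_class_def higher_deriv_eq_tcoeff)

text \<open>The identity behind the invariance of the disk under u -> (u - c) / (1 -
  \<open>cnj c\<close> u). It serves the Schwarz-Pick bound as well as the extremal
  function.\<close>

lemma Moebius_norm_identity:
  "(cmod (1 - cnj c * u))\<^sup>2 - (cmod (u - c))\<^sup>2 = (1 - (cmod c)\<^sup>2) * (1 - (cmod u)\<^sup>2)"
  unfolding cmod_power2 by (simp add: power2_eq_square algebra_simps)

text \<open>The Schwarz lemma is applied to \<open>g\<close>, the composition of \<open>f\<close>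
  with the disk automorphism that sends \<open>f 0\<close> to 0. What remains is to pass from
  complex values to their moduli.\<close>

lemma Schwarz_Pick_bound:
  assumes f: "f \<in> \<B>" and a: "cmod (f 0) < 1" and w: "cmod w < 1"
  shows "cmod (f w) \<le> (cmod (f 0) + cmod w) / (1 + cmod (f 0) * cmod w)"
proof -
  define c where "c = f 0"
  define g where "g = (\<lambda>z. (f z - c) / (1 - cnj c * f z))"
  have hf: "f holomorphic_on ball 0 1" and bf: "\<And>z. cmod z < 1 \<Longrightarrow> cmod (f z) \<le> 1"
    using f by (auto simp: unit_disk_class_iff)
  have c1: "cmod c < 1" using a by (simp add: c_def)
  have lt: "cmod (cnj c * f z) < 1" if "cmod z < 1" for z
  proof -
    have "cmod (cnj c * f z) \<le> cmod c * 1"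
      using bf[OF that] by (simp add: norm_mult mult_left_le)
    thus ?thesis using c1 by simp
  qed
  have nz: "1 - cnj c * f z \<noteq> 0" if "cmod z < 1" for z
    using lt[OF that] by auto
  have "cmod (g z) \<le> 1" if z: "cmod z < 1" for z
  proof -
    have "0 \<le> (1 - (cmod c)\<^sup>2) * (1 - (cmod (f z))\<^sup>2)"
      using c1 bf[OF z] by (intro mult_nonneg_nonneg) (auto simp: power_le_one)
    hence "(cmod (f z - c))\<^sup>2 \<le> (cmod (1 - cnj c * f z))\<^sup>2"
      using Moebius_norm_identity[of c "f z"] by linarith
    hence "cmod (f z - c) \<le> cmod (1 - cnj c * f z)"
      by (rule power2_le_imp_le) (rule norm_ge_zero)
    thus ?thesis using nz[OF z] by (simp add: g_def norm_divide)
  qed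
  hence gB: "g \<in> \<B>"
    unfolding unit_disk_class_iff g_def using nz by (auto intro!: holomorphic_intros hf)
  have "g 0 = 0" by (simp add: g_def c_def)
  hence "cmod (g w) \<le> cmod w"
    using Schwarz_zero_order[OF gB, of 1 w] w by (simp add: tcoeff_0)
  hence le: "cmod (f w - c) \<le> cmod w * cmod (1 - cnj c * f w)"
    using nz[OF w] by (simp add: g_def norm_divide field_simps)
  define s where "s = cmod w"
  define \<alpha> where "\<alpha> = cmod c"
  define \<beta> where "\<beta> = cmod (f w)"
  have bounds: "0 \<le> s" "s < 1" "0 \<le> \<alpha>" "\<alpha> < 1" "0 \<le> \<beta>" "\<beta> \<le> 1"
    using w c1 bf[OF w] by (auto simp: s_def \<alpha>_def \<beta>_def)
  have ab: "\<alpha> * \<beta> \<le> 1" using bounds by (intro mult_le_one) auto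
  have "(cmod (f w - c))\<^sup>2 \<le> (s * cmod (1 - cnj c * f w))\<^sup>2"
    using le by (intro power_mono) (auto simp: s_def)
  hence 1: "(1 - s\<^sup>2) * (cmod (1 - cnj c * f w))\<^sup>2 \<le> (1 - \<alpha>\<^sup>2) * (1 - \<beta>\<^sup>2)"
    using Moebius_norm_identity[of c "f w"] by (simp add: \<alpha>_def \<beta>_def power_mult_distrib algebra_simps)
  \<comment> \<open>In the inequality labelled 1 the arguments of \<open>c\<close> and
    \<open>f w\<close> enter only through \<open>cmod (1 - cnj c * f w)\<close>. Replacing it by its
    least possible value leaves a real inequality, which the Moebius identity for real numbers turns
    back into one for \<open>\<beta> - \<alpha>\<close>.\<close>
  have "1 - \<alpha> * \<beta> \<le> cmod (1 - cnj c * f w)"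
    using norm_triangle_ineq2[of 1 "cnj c * f w"] by (simp add: \<alpha>_def \<beta>_def norm_mult)
  hence "(1 - \<alpha> * \<beta>)\<^sup>2 \<le> (cmod (1 - cnj c * f w))\<^sup>2"
    using ab by (intro power_mono) auto
  hence "(1 - s\<^sup>2) * (1 - \<alpha> * \<beta>)\<^sup>2 \<le> (1 - s\<^sup>2) * (cmod (1 - cnj c * f w))\<^sup>2"
    using bounds by (intro mult_left_mono) (auto simp: power_le_one)
  with 1 have "(1 - s\<^sup>2) * (1 - \<alpha> * \<beta>)\<^sup>2 \<le> (1 - \<alpha>\<^sup>2) * (1 - \<beta>\<^sup>2)" by linarith
  hence "(\<beta> - \<alpha>)\<^sup>2 \<le> (s * (1 - \<alpha> * \<beta>))\<^sup>2"
    by (simp add: power2_eq_square algebra_simps)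
  moreover have "0 \<le> s * (1 - \<alpha> * \<beta>)" using ab bounds by simp
  ultimately have "\<beta> - \<alpha> \<le> s * (1 - \<alpha> * \<beta>)" by (rule power2_le_imp_le)
  moreover have "0 < 1 + \<alpha> * s" using bounds by (intro add_pos_nonneg) auto
  ultimately have "\<beta> \<le> (\<alpha> + s) / (1 + \<alpha> * s)"
    by (simp add: field_simps)
  thus ?thesis by (simp add: \<alpha>_def \<beta>_def s_def c_def)
qed

section \<open>Carlson's coefficient inequalities\<close>

text \<open>The first unit vector is mapped to the first column of the Toeplitz matrix, which is the
  vector of coefficients.\<close>

lemma sum_tcoeff_norm_le_1:
  assumes "f \<in> \<B>"
  shows "(\<Sum>j\<le>n. (cmod (tcoeff f j))\<^sup>2) \<le> 1"
proof -
  define \<delta> where "\<delta> i = (if i = 0 then 1 else 0 :: complex)" for i :: nat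
  have "(\<Sum>j\<le>i. tcoeff f (i - j) * \<delta> j) = tcoeff f i" for i
    by (simp add: \<delta>_def if_distrib cong: if_cong)
  hence "(\<Sum>i\<le>n. (cmod (tcoeff f i))\<^sup>2) \<le> (\<Sum>i\<le>n. (cmod (\<delta> i))\<^sup>2)"
    using Toeplitz_contraction[OF assms, where g = \<delta> and N = n] by simp
  also have "\<dots> = 1"
    by (simp add: \<delta>_def if_distrib[of cmod] if_distrib[of "\<lambda>x. x\<^sup>2"] cong: if_cong)
  finally show ?thesis .
qed

text \<open>The test vector is \<open>e\<close> on the first \<open>M + 1\<close> indices, continued by a multiple of the
  conjugated reversed coefficients; the multiple is then optimised.\<close>
lemma coefficient_corner_bound:
  fixes e :: "nat \<Rightarrow> complex"
  assumes f: "f \<in> \<B>" and n: "0 < n"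
  shows "(cmod (\<Sum>j\<le>M. tcoeff f (M + n - j) * e j))\<^sup>2 \<le>
    (1 - (\<Sum>j<n. (cmod (tcoeff f j))\<^sup>2)) *
    ((\<Sum>i\<le>M. (cmod (e i))\<^sup>2) - (\<Sum>i\<le>M. (cmod (\<Sum>j\<le>i. tcoeff f (i - j) * e j))\<^sup>2))"
proof -
  define a where "a = tcoeff f"
  define X where "X = (\<Sum>j\<le>M. a (M + n - j) * e j)"
  define S where "S = (\<Sum>j<n. (cmod (a j))\<^sup>2)"
  define K where "K = (\<Sum>i\<le>M. (cmod (e i))\<^sup>2) - (\<Sum>i\<le>M. (cmod (\<Sum>j\<le>i. a (i - j) * e j))\<^sup>2)"
  have reindex: "sum u {Suc M..M + n} = (\<Sum>l<n. u (M + n - l))" for u :: "nat \<Rightarrow> 'a::comm_monoid_add"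
    by (rule sum.reindex_bij_witness[of _ "\<lambda>l. M + n - l" "\<lambda>j. M + n - j"]) auto
  \<comment> \<open>Of the image vector only the entries up to \<open>M\<close> and the last one, of
    index \<open>M + n\<close>, are kept. The former see only \<open>e\<close>; in the last one the
    conjugated reversed coefficients meet the coefficients themselves and contribute
    \<open>w * of_real S\<close>.\<close>
  have test: "(cmod (X + w * of_real S))\<^sup>2 \<le> K + (cmod w)\<^sup>2 * S" for w
  proof -
    define g where "g i = (if i \<le> M then e i else w * cnj (a (M + n - i)))" for i
    define b where "b i = (\<Sum>j\<le>i. a (i - j) * g j)" for i
    have b_low: "b i = (\<Sum>j\<le>i. a (i - j) * e j)" if "i \<le> M" for i
      unfolding b_def using that by (intro sum.cong) (auto simp: g_def)
    have "b (M + n) = (\<Sum>j\<le>M. a (M + n - j) * g j) + (\<Sum>j=Suc M..M+n. a (M + n - j) * g j)"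
      unfolding b_def by (rule sum_up_index_split)
    also have "(\<Sum>j=Suc M..M+n. a (M + n - j) * g j) = w * of_real S"
      unfolding reindex S_def of_real_sum sum_distrib_left
      by (intro sum.cong) (auto simp: g_def complex_norm_square[symmetric] mult_ac)
    also have "(\<Sum>j\<le>M. a (M + n - j) * g j) = X"
      unfolding X_def by (intro sum.cong) (auto simp: g_def)
    finally have b_top: "b (M + n) = X + w * of_real S" .
    have "(\<Sum>i\<le>M. (cmod (b i))\<^sup>2) + (cmod (b (M + n)))\<^sup>2
        = (\<Sum>i\<in>insert (M + n) {..M}. (cmod (b i))\<^sup>2)"
      using n by simp
    also have "\<dots> \<le> (\<Sum>i\<le>M+n. (cmod (b i))\<^sup>2)"
      by (intro sum_mono2) auto
    also have "\<dots> \<le> (\<Sum>i\<le>M+n. (cmod (g i))\<^sup>2)"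
      unfolding b_def a_def by (rule Toeplitz_contraction[OF f])
    also have "\<dots> = (\<Sum>i\<le>M. (cmod (g i))\<^sup>2) + (\<Sum>i=Suc M..M+n. (cmod (g i))\<^sup>2)"
      by (rule sum_up_index_split)
    also have "(\<Sum>i=Suc M..M+n. (cmod (g i))\<^sup>2) = (cmod w)\<^sup>2 * S"
      unfolding reindex S_def sum_distrib_left
      by (intro sum.cong) (auto simp: g_def norm_mult power_mult_distrib)
    also have "(\<Sum>i\<le>M. (cmod (g i))\<^sup>2) = (\<Sum>i\<le>M. (cmod (e i))\<^sup>2)"
      by (intro sum.cong) (auto simp: g_def)
    finally show ?thesis
      by (simp add: K_def b_top b_low)
  qed
  have "S \<le> 1"
  proof -
    have "(\<Sum>i\<le>n. (cmod (a i))\<^sup>2) \<le> 1"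
      unfolding a_def by (rule sum_tcoeff_norm_le_1[OF f])
    moreover have "S \<le> (\<Sum>i\<le>n. (cmod (a i))\<^sup>2)"
      unfolding S_def by (intro sum_mono2) auto
    ultimately show ?thesis by simp
  qed
  have "(cmod X)\<^sup>2 \<le> (1 - S) * K"
  proof (cases "S = 1")
    case False
    define D where "D = 1 - S"
    have D: "0 < D" "S = 1 - D" using False \<open>S \<le> 1\<close> by (auto simp: D_def)
    \<comment> \<open>Along multiples of \<open>X\<close>, the choice
      \<open>w = X / of_real D\<close> maximises the left side of \<open>test\<close> minus
      \<open>(cmod w)\<^sup>2 * S\<close>.\<close>
    have "X + X / of_real D * of_real S = X / of_real D"
      using D(1) unfolding D(2) by (simp add: field_simps)
    hence "(cmod X)\<^sup>2 / D\<^sup>2 \<le> K + (cmod X)\<^sup>2 / D\<^sup>2 * (1 - D)"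
      using test[of "X / of_real D"] D(1) by (simp add: D(2) norm_divide power_divide)
    hence "(cmod X)\<^sup>2 \<le> D * K"
      using D(1) by (simp add: field_simps power2_eq_square)
    thus ?thesis by (simp add: D(2))
  next
    case True
    have "(cmod X)\<^sup>2 \<le> K" using test[of 0] by simp
    \<comment> \<open>For \<open>S = 1\<close> the terms quadratic in \<open>t\<close> cancel in
      \<open>test\<close>, leaving a bound on a linear function of \<open>t\<close>. This value of
      \<open>t\<close> would force \<open>K\<close> to be negative, although
      \<open>(cmod X)\<^sup>2 \<le> K\<close>; hence \<open>X = 0\<close>.\<close>
    define t where "t = K / (cmod X)\<^sup>2"
    show ?thesis
    proof (cases "X = 0")
      case False
      have "X + of_real t * X = of_real (1 + t) * X" by (simp add: algebra_simps)
      hence "(1 + t)\<^sup>2 * (cmod X)\<^sup>2 \<le> K + t\<^sup>2 * (cmod X)\<^sup>2"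
        using test[of "of_real t * X"] True
        by (simp add: norm_mult power_mult_distrib del: of_real_add)
      hence "(cmod X)\<^sup>2 + 2 * (t * (cmod X)\<^sup>2) \<le> K"
        by (simp add: power2_eq_square algebra_simps)
      hence "(cmod X)\<^sup>2 + 2 * K \<le> K" using False by (simp add: t_def)
      moreover have "0 < (cmod X)\<^sup>2" using False by simp
      ultimately show ?thesis using \<open>(cmod X)\<^sup>2 \<le> K\<close> by linarith
    qed (simp add: True)
  qed
  thus ?thesis by (simp add: X_def S_def K_def a_def)
qed

text \<open>With the first unit vector as \<open>e\<close> and \<open>Suc n\<close> in place of
  \<open>n\<close>, the corner entry has index \<open>n + Suc n\<close>, and both factors of the
  corner bound become the same number, so a square root can be taken.\<close>

lemma Carlson_odd:
  assumes f: "f \<in> \<B>"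
  shows "cmod (tcoeff f (2*n + 1)) \<le> 1 - (\<Sum>j\<le>n. (cmod (tcoeff f j))\<^sup>2)"
proof -
  define \<delta> where "\<delta> i = (if i = 0 then 1 else 0 :: complex)" for i :: nat
  have 1: "(\<Sum>j\<le>i. u (i - j) * \<delta> j) = u i" for i and u :: "nat \<Rightarrow> complex"
    by (simp add: \<delta>_def if_distrib cong: if_cong)
  have 2: "(\<Sum>j\<le>n. tcoeff f (n + Suc n - j) * \<delta> j) = tcoeff f (2*n + 1)"
    by (simp add: \<delta>_def if_distrib mult_2 cong: if_cong)
  have 3: "(\<Sum>i\<le>n. (cmod (\<delta> i))\<^sup>2) = 1"
    by (simp add: \<delta>_def if_distrib[of cmod] if_distrib[of "\<lambda>x. x\<^sup>2"] cong: if_cong)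
  have "(cmod (tcoeff f (2*n + 1)))\<^sup>2 \<le> (1 - (\<Sum>j\<le>n. (cmod (tcoeff f j))\<^sup>2))\<^sup>2"
    using coefficient_corner_bound[OF f zero_less_Suc[of n], where M = n and e = \<delta>]
    unfolding 1 2 3 lessThan_Suc_atMost by (simp add: power2_eq_square)
  thus ?thesis
    by (rule power2_le_imp_le) (use sum_tcoeff_norm_le_1[OF f] in simp)
qed

text \<open>The first unit vector alone would give only the bound \<open>1 - S\<close>. An
  additional entry \<open>\<beta>\<close> at position \<open>n\<close> adds the modulus of
  \<open>\<beta> * a n\<close> to the corner entry, while its size is chosen so that the second
  factor of the corner bound does not exceed \<open>1 - S\<close>.\<close>

lemma Carlson_even:
  assumes f: "f \<in> \<B>" and n: "0 < n"
  shows "cmod (tcoeff f (2*n)) \<le>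
    1 - (\<Sum>j<n. (cmod (tcoeff f j))\<^sup>2) - (cmod (tcoeff f n))\<^sup>2 / (1 + cmod (tcoeff f 0))"
proof -
  define a where "a = tcoeff f"
  \<comment> \<open>This \<open>q\<close> solves \<open>cmod (a n) - q * cmod (a 0) = q\<close>.
    Thus the entry of index \<open>n\<close> of the image has modulus at least \<open>q\<close>,
    which pays for the term \<open>q\<^sup>2\<close> in the norm of the test vector.\<close>
  define q where "q = cmod (a n) / (1 + cmod (a 0))"
  define S where "S = (\<Sum>j<n. (cmod (a j))\<^sup>2)"
  have pos: "0 < 1 + cmod (a 0)" by (intro add_pos_nonneg) auto
  have q0: "0 \<le> q" using pos by (simp add: q_def)
  \<comment> \<open>The phase of \<open>\<beta>\<close> aligns \<open>\<beta> a\<^sub>n\<close> with \<open>a\<^sub>2\<^sub>n\<close>.\<close>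
  obtain \<beta> where \<beta>: "cmod \<beta> = q" "cmod (a (2*n) + \<beta> * a n) = cmod (a (2*n)) + q * cmod (a n)"
  proof -
    \<comment> \<open>Unlike \<open>sgn\<close>, this phase has modulus 1 at 0 too, so
      \<open>cmod \<beta> = q\<close> also holds when a coefficient vanishes.\<close>
    define sg where "sg z = (if z = 0 then 1 else sgn z)" for z :: complex
    have sg: "cmod (sg z) = 1" "of_real (cmod z) * sg z = z" for z
      by (simp_all add: sg_def norm_sgn) (simp add: sgn_eq)
    define \<beta> where "\<beta> = of_real q * sg (a (2*n)) * cnj (sg (a n))"
    have "cnj (sg (a n)) * sg (a n) = 1"
      using sg(1)[of "a n"] by (simp add: complex_norm_square[symmetric] mult.commute)
    hence an: "cnj (sg (a n)) * a n = of_real (cmod (a n))"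
      by (metis sg(2) mult.left_commute mult.right_neutral)
    have "a (2*n) + \<beta> * a n = of_real (cmod (a (2*n)) + q * cmod (a n)) * sg (a (2*n))"
      unfolding \<beta>_def mult.assoc an using sg(2)[of "a (2*n)"]
      by (simp add: algebra_simps)
    hence "cmod (a (2*n) + \<beta> * a n) = \<bar>cmod (a (2*n)) + q * cmod (a n)\<bar>"
      by (simp add: norm_mult sg(1) del: of_real_add)
    moreover have "cmod \<beta> = q" using q0 by (simp add: \<beta>_def norm_mult sg(1))
    ultimately show ?thesis using q0 by (intro that[of \<beta>]) auto
  qed
  define e where "e i = (if i = 0 then 1 else if i = n then \<beta> else 0)" for i :: nat
  have e_sum: "(\<Sum>j\<le>i. u j * e j) = u 0 + (if n \<le> i then \<beta> * u n else 0)"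
    for i and u :: "nat \<Rightarrow> complex"
  proof -
    have "(\<Sum>j\<le>i. u j * e j) = (\<Sum>j\<le>i. (if j = 0 then u 0 else 0) + (if j = n then \<beta> * u n else 0))"
      using n by (intro sum.cong) (auto simp: e_def)
    thus ?thesis by (simp add: sum.distrib)
  qed
  have "(\<Sum>j\<le>n. a (n + n - j) * e j) = a (2*n) + \<beta> * a n"
    using e_sum[of "\<lambda>j. a (n + n - j)" n] by (simp add: mult_2)
  moreover have "(\<Sum>i\<le>n. (cmod (e i))\<^sup>2) = 1 + q\<^sup>2"
  proof -
    have "(\<Sum>i\<le>n. (cmod (e i))\<^sup>2) = (\<Sum>i\<le>n. (if i = 0 then 1 else 0) + (if i = n then q\<^sup>2 else 0))"
      using n by (intro sum.cong) (auto simp: e_def \<beta>)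
    thus ?thesis by (simp add: sum.distrib)
  qed
  moreover have "(\<Sum>i\<le>n. (cmod (\<Sum>j\<le>i. a (i - j) * e j))\<^sup>2) = S + (cmod (a n + \<beta> * a 0))\<^sup>2"
  proof -
    have "(\<Sum>j\<le>i. a (i - j) * e j) = a i + (if n \<le> i then \<beta> * a (i - n) else 0)" for i
      using e_sum[of "\<lambda>j. a (i - j)" i] by simp
    thus ?thesis by (simp add: S_def flip: lessThan_Suc_atMost)
  qed
  moreover note coefficient_corner_bound[OF f n, where M = n and e = e]
  ultimately have main: "(cmod (a (2*n)) + q * cmod (a n))\<^sup>2 \<le>
      (1 - S) * (1 + q\<^sup>2 - (S + (cmod (a n + \<beta> * a 0))\<^sup>2))"
    unfolding S_def a_def[symmetric] \<beta>(2)[symmetric] by simp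
  have "cmod (a n) - cmod (\<beta> * a 0) \<le> cmod (a n + \<beta> * a 0)"
    by (rule norm_diff_ineq)
  moreover have "q * (1 + cmod (a 0)) = cmod (a n)"
    using pos by (simp add: q_def)
  ultimately have "q \<le> cmod (a n + \<beta> * a 0)"
    by (simp add: norm_mult \<beta>(1) distrib_left)
  hence "q\<^sup>2 \<le> (cmod (a n + \<beta> * a 0))\<^sup>2" using q0 by (rule power_mono)
  moreover have S1: "S \<le> 1"
  proof -
    have "S \<le> (\<Sum>j\<le>n. (cmod (a j))\<^sup>2)" unfolding S_def by (intro sum_mono2) auto
    thus ?thesis using sum_tcoeff_norm_le_1[OF f, of n] by (simp add: a_def)
  qed
  ultimately have "(1 - S) * (1 + q\<^sup>2 - (S + (cmod (a n + \<beta> * a 0))\<^sup>2)) \<le> (1 - S) * (1 - S)"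
    by (intro mult_left_mono) auto
  with main have "(cmod (a (2*n)) + q * cmod (a n))\<^sup>2 \<le> (1 - S)\<^sup>2"
    by (simp add: power2_eq_square)
  hence "cmod (a (2*n)) + q * cmod (a n) \<le> 1 - S"
    by (rule power2_le_imp_le) (use S1 in simp)
  thus ?thesis
    by (simp add: q_def S_def a_def power2_eq_square)
qed

section \<open>The sharp bound for \<open>B1 + A_term\<close>\<close>

text \<open>The subtracted remainder makes the sum telescope: step \<open>N\<close> inserts
  Carlson's inequalities for the indices \<open>2*N+1\<close> and \<open>2*N+2\<close>, and
  everything after that is an equality.\<close>

lemma B1_A_term_partial_sum:
  fixes \<rho> :: real
  assumes f: "f \<in> \<B>" and \<rho>: "0 \<le> \<rho>" "\<rho> < 1"
  defines "a \<equiv> \<lambda>n. cmod (tcoeff f n)"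
  shows "(\<Sum>i<2*N. a (Suc i) * \<rho> ^ Suc i) +
      (1 / (1 + a 0) + \<rho> / (1 - \<rho>)) * (\<Sum>j<N. (a (Suc j))\<^sup>2 * \<rho> ^ (2 * Suc j))
    \<le> (1 - (a 0)\<^sup>2) * (\<rho> / (1 - \<rho>)) - (1 - (\<Sum>j\<le>N. (a j)\<^sup>2)) * (\<rho> ^ (2*N+1) / (1 - \<rho>))"
proof (induction N)
  case 0
  show ?case by simp
next
  case (Suc N)
  define D where "D = 1 - (\<Sum>j\<le>N. (a j)\<^sup>2)"
  define s where "s = (a (Suc N))\<^sup>2"
  define P where "P = \<rho> ^ (2*N+1)"
  define \<kappa> where "\<kappa> = 1 / (1 + a 0)"
  have P: "0 \<le> P" using \<rho> by (simp add: P_def)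
  have odd: "a (2*N+1) \<le> D"
    using Carlson_odd[OF f, of N] by (simp add: D_def a_def)
  have even: "a (2*N+2) \<le> D - \<kappa> * s"
    using Carlson_even[OF f zero_less_Suc, of N]
    by (simp add: D_def a_def s_def \<kappa>_def lessThan_Suc_atMost)
  have "a (2*N+1) * P + a (2*N+2) * (\<rho> * P) + (\<kappa> + \<rho> / (1 - \<rho>)) * (s * (\<rho> * P))
      \<le> D * P + (D - \<kappa> * s) * (\<rho> * P) + (\<kappa> + \<rho> / (1 - \<rho>)) * (s * (\<rho> * P))"
    using odd even P \<rho> by (intro add_mono mult_right_mono order_refl) auto
  \<comment> \<open>The summand with \<open>\<kappa>\<close> cancels the gain in Carlson's even
    inequality; the one with \<open>\<rho> / (1 - \<rho>)\<close> accounts for the drop of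
    \<open>D\<close> to \<open>D - s\<close> in the new remainder.\<close>
  also have "\<dots> = D * (P / (1 - \<rho>)) - (D - s) * (\<rho>\<^sup>2 * P / (1 - \<rho>))"
  proof -
    define u where "u = 1 / (1 - \<rho>)"
    have "u = 1 + \<rho> * u" using \<rho> by (simp add: u_def field_simps)
    hence "D * P + (D - \<kappa> * s) * (\<rho> * P) + (\<kappa> + \<rho> * u) * (s * (\<rho> * P))
        = D * (P * u) - (D - s) * (\<rho>\<^sup>2 * P * u)"
      by algebra
    thus ?thesis by (simp add: u_def)
  qed
  finally have step: "a (2*N+1) * P + a (2*N+2) * (\<rho> * P) + (\<kappa> + \<rho> / (1 - \<rho>)) * (s * (\<rho> * P))
      \<le> D * (P / (1 - \<rho>)) - (D - s) * (\<rho>\<^sup>2 * P / (1 - \<rho>))" .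
  have 1: "(\<Sum>i<2*Suc N. a (Suc i) * \<rho> ^ Suc i) =
      (\<Sum>i<2*N. a (Suc i) * \<rho> ^ Suc i) + a (2*N+1) * P + a (2*N+2) * (\<rho> * P)"
    by (simp add: P_def)
  have 2: "(\<Sum>j<Suc N. (a (Suc j))\<^sup>2 * \<rho> ^ (2 * Suc j)) =
      (\<Sum>j<N. (a (Suc j))\<^sup>2 * \<rho> ^ (2 * Suc j)) + s * (\<rho> * P)"
    by (simp add: P_def s_def)
  have 3: "1 - (\<Sum>j\<le>Suc N. (a j)\<^sup>2) = D - s" "\<rho> ^ (2 * Suc N + 1) = \<rho>\<^sup>2 * P"
    by (simp_all add: D_def s_def P_def power2_eq_square)
  show ?case
    using Suc.IH step unfolding 1 2 3 \<kappa>_def[symmetric] D_def[symmetric] P_def[symmetric]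
    by (simp only: distrib_left)
qed

text \<open>The nonnegative remainder is dropped and \<open>N\<close> tends to infinity;
  \<open>B1\<close> is reached along its partial sums of even length. Comparison with the geometric
  series gives convergence.\<close>

lemma B1_A_term_le:
  assumes f: "f \<in> \<B>" and \<rho>: "0 \<le> \<rho>" "\<rho> < 1"
  shows "B1 f \<rho> + A_term f \<rho> \<le> (1 - (cmod (f 0))\<^sup>2) * (\<rho> / (1 - \<rho>))"
proof -
  define a where "a = (\<lambda>n. cmod (tcoeff f n))"
  have a1: "a n \<le> 1" for n
  proof -
    have "(a n)\<^sup>2 \<le> (\<Sum>j\<le>n. (a j)\<^sup>2)" by (rule member_le_sum) auto
    also have "\<dots> \<le> 1" unfolding a_def by (rule sum_tcoeff_norm_le_1[OF f])
    finally have "(a n)\<^sup>2 \<le> 1" .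
    thus ?thesis by (simp add: a_def power_le_one_iff)
  qed
  have geo: "summable (\<lambda>n. \<rho> ^ Suc n)"
    using \<rho> by (simp add: summable_geometric)
  have s1: "summable (\<lambda>i. a (Suc i) * \<rho> ^ Suc i)"
  proof (rule summable_comparison_test'[OF geo])
    show "norm (a (Suc n) * \<rho> ^ Suc n) \<le> \<rho> ^ Suc n" for n
      using mult_right_mono[OF a1[of "Suc n"], of "\<rho> ^ Suc n"] \<rho> by (simp add: a_def abs_mult)
  qed
  have s2: "summable (\<lambda>j. (a (Suc j))\<^sup>2 * \<rho> ^ (2 * Suc j))"
  proof (rule summable_comparison_test'[OF geo])
    fix n
    have "(a (Suc n))\<^sup>2 * \<rho> ^ (2 * Suc n) \<le> 1 * \<rho> ^ Suc n"
      using \<rho> a1[of "Suc n"]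
      by (intro mult_mono power_decreasing) (auto simp: a_def power_le_one)
    thus "norm ((a (Suc n))\<^sup>2 * \<rho> ^ (2 * Suc n)) \<le> \<rho> ^ Suc n"
      using \<rho> by simp
  qed
  let ?c = "1 / (1 + a 0) + \<rho> / (1 - \<rho>)"
  have dbl: "filterlim (\<lambda>N::nat. 2 * N) at_top at_top"
    by (rule filterlim_subseq) (auto simp: strict_mono_def)
  have "(\<lambda>N. (\<Sum>i<2*N. a (Suc i) * \<rho> ^ Suc i) + ?c * (\<Sum>j<N. (a (Suc j))\<^sup>2 * \<rho> ^ (2 * Suc j)))
     \<longlonglongrightarrow> (\<Sum>i. a (Suc i) * \<rho> ^ Suc i) + ?c * (\<Sum>j. (a (Suc j))\<^sup>2 * \<rho> ^ (2 * Suc j))"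
    by (intro tendsto_intros summable_LIMSEQ s2
        filterlim_compose[OF summable_LIMSEQ[OF s1] dbl])
  moreover have "(\<Sum>i<2*N. a (Suc i) * \<rho> ^ Suc i) + ?c * (\<Sum>j<N. (a (Suc j))\<^sup>2 * \<rho> ^ (2 * Suc j))
      \<le> (1 - (a 0)\<^sup>2) * (\<rho> / (1 - \<rho>))" for N
  proof -
    have "0 \<le> (1 - (\<Sum>j\<le>N. (a j)\<^sup>2)) * (\<rho> ^ (2*N+1) / (1 - \<rho>))"
      using sum_tcoeff_norm_le_1[OF f, of N] \<rho>
      by (intro mult_nonneg_nonneg divide_nonneg_nonneg) (auto simp: a_def)
    thus ?thesis
      using B1_A_term_partial_sum[OF f \<rho>, of N, folded a_def] unfolding a_def by linarith
  qed
  ultimately have "(\<Sum>i. a (Suc i) * \<rho> ^ Suc i) + ?c * (\<Sum>j. (a (Suc j))\<^sup>2 * \<rho> ^ (2 * Suc j))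
      \<le> (1 - (a 0)\<^sup>2) * (\<rho> / (1 - \<rho>))"
    by (intro LIMSEQ_le_const2) auto
  thus ?thesis
    by (simp add: B1_def A_term_def a_def tcoeff_0)
qed

section \<open>The majorant, its monotonicity, and the root of \<open>Psi4\<close>\<close>

text \<open>The function \<open>\<Phi>\<close> of the overview: the bound for \<open>C_fun\<close>
  on the circle of radius \<open>r\<close>, attained by the extremal functions.\<close>

definition Bohr_majorant :: "real \<Rightarrow> real \<Rightarrow> real \<Rightarrow> nat \<Rightarrow> nat \<Rightarrow> real \<Rightarrow> real" where
  "Bohr_majorant p lam a m k r =
     ((a + r ^ m) / (1 + a * r ^ m)) powr p + lam * ((1 - a\<^sup>2) * (r ^ k / (1 - r ^ k)))"

lemma divide_one_minus_mono:
  fixes x y :: real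
  assumes "0 \<le> x" "x \<le> y" "y < 1"
  shows "x / (1 - x) \<le> y / (1 - y)"
  using assms by (intro frac_le) auto

lemma pseudohyperbolic_sum_mono:
  fixes a x y :: real
  assumes "0 \<le> a" "a \<le> 1" "0 \<le> x" "x \<le> y"
  shows "(a + x) / (1 + a * x) \<le> (a + y) / (1 + a * y)"
proof -
  have "0 < 1 + a * x" "0 < 1 + a * y"
    using assms by (auto intro!: add_pos_nonneg)
  moreover have "a\<^sup>2 * (y - x) \<le> 1 * (y - x)"
    using assms by (intro mult_right_mono) (auto simp: power_le_one)
  ultimately show ?thesis
    by (simp add: divide_simps) (simp add: algebra_simps power2_eq_square)
qed

text \<open>Strictness comes from the summand with \<open>lam\<close>; for the other summand weak
  monotonicity is enough.\<close>

lemma Bohr_majorant_strict_mono: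
  assumes "1 \<le> k" "0 < p" "0 < lam" "0 \<le> a" "a < 1" "0 \<le> r" "r < s" "s < 1"
  shows "Bohr_majorant p lam a m k r < Bohr_majorant p lam a m k s"
proof -
  have "r ^ k < s ^ k" "s ^ k < 1" "0 \<le> r ^ k"
    using assms by (auto intro!: power_strict_mono power_Suc_less_one simp: power_less_one_iff)
  hence "r ^ k / (1 - r ^ k) < s ^ k / (1 - s ^ k)"
    by (intro frac_less) auto
  moreover have "0 < 1 - a\<^sup>2" using assms by (simp add: power_less_one_iff)
  ultimately have "lam * ((1 - a\<^sup>2) * (r ^ k / (1 - r ^ k))) < lam * ((1 - a\<^sup>2) * (s ^ k / (1 - s ^ k)))"
    using assms(3) by (intro mult_strict_left_mono)
  moreover have "((a + r ^ m) / (1 + a * r ^ m)) powr p \<le> ((a + s ^ m) / (1 + a * s ^ m)) powr p"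
    using assms by (intro powr_mono2 pseudohyperbolic_sum_mono power_mono divide_nonneg_nonneg) auto
  ultimately show ?thesis by (simp add: Bohr_majorant_def)
qed

lemma Psi4_eq:
  assumes "1 \<le> k" "0 \<le> a" "0 \<le> r" "r < 1"
  shows "Psi4 p lam a m k r =
    (1 - r ^ k) * (1 + a * r ^ m) powr p * (1 - Bohr_majorant p lam a m k r)"
proof -
  have "r ^ k < 1" using assms by (simp add: power_less_one_iff)
  hence u: "(1 - r ^ k) * (r ^ k / (1 - r ^ k)) = r ^ k" by simp
  have pos: "0 < 1 + a * r ^ m" using assms by (intro add_pos_nonneg) auto
  have v: "(1 + a * r ^ m) powr p * ((a + r ^ m) / (1 + a * r ^ m)) powr p = (a + r ^ m) powr p"
    using pos assms by (simp add: powr_divide)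
  \<comment> \<open>Powers and quotients are abstracted to variables, so that only polynomial
    algebra modulo the equations \<open>u\<close> and \<open>v\<close> remains.\<close>
  have "V * (1 + (lam * a\<^sup>2 - lam - 1) * x) - (1 - x) * Z =
      (1 - x) * V * (1 - (W + lam * ((1 - a\<^sup>2) * q)))"
    if "(1 - x) * q = x" "V * W = Z" for V W Z x q :: real
  proof -
    have "(1 - x) * V * (1 - (W + lam * ((1 - a\<^sup>2) * q)))
        = (1 - x) * V - (1 - x) * (V * W) - V * (lam * (1 - a\<^sup>2) * ((1 - x) * q))"
      by (simp add: algebra_simps)
    thus ?thesis unfolding that by (simp add: algebra_simps)
  qed
  from this[OF u v] show ?thesis
    by (simp only: Psi4_def Bohr_majorant_def)
qed

lemma Psi4_eq_0_iff:
  assumes "1 \<le> k" "0 \<le> a" "0 \<le> r" "r < 1"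
  shows "Psi4 p lam a m k r = 0 \<longleftrightarrow> Bohr_majorant p lam a m k r = 1"
proof -
  have "r ^ k < 1" using assms by (simp add: power_less_one_iff)
  moreover have "0 < 1 + a * r ^ m" using assms by (intro add_pos_nonneg) auto
  ultimately show ?thesis using Psi4_eq[OF assms, of p lam m] by simp
qed

text \<open>The intermediate value theorem is applied to \<open>Psi4\<close> rather than to the
  majorant, because \<open>Psi4\<close> is continuous up to \<open>r = 1\<close>, where the majorant
  blows up.\<close>

lemma Psi4_root_exists:
  assumes "1 \<le> k" "1 \<le> m" "0 < p" "0 < lam" "0 \<le> a" "a < 1"
  shows "\<exists>r. 0 < r \<and> r < 1 \<and> Psi4 p lam a m k r = 0"
proof -
  let ?\<Psi> = "Psi4 p lam a m k"
  have nz: "1 + a * r ^ m \<noteq> 0" if "0 \<le> r" for r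
    using that assms by (metis add_pos_nonneg less_irrefl mult_nonneg_nonneg zero_le_power zero_less_one)
  have 0: "?\<Psi> 0 > 0"
  proof -
    have "a powr p < 1"
      using assms powr_less_mono2[of p a 1] by simp
    thus ?thesis using assms by (simp add: Psi4_def zero_power)
  qed
  have 1: "?\<Psi> 1 < 0"
  proof -
    have "lam * a\<^sup>2 - lam < 0" using assms by (simp add: power_less_one_iff)
    moreover have "0 < (1 + a) powr p" using assms by simp
    ultimately show ?thesis by (simp add: Psi4_def mult_pos_neg)
  qed
  \<comment> \<open>For \<open>a = 0\<close> the base \<open>a + r ^ m\<close> vanishes at
    \<open>r = 0\<close>; there continuity rests on \<open>0 < p\<close>.\<close>
  have "continuous_on {0..1} ?\<Psi>"
    unfolding Psi4_def using assms nz
    by (intro continuous_intros continuous_on_powr') auto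
  then obtain r where r: "0 \<le> r" "r \<le> 1" "?\<Psi> r = 0"
    using IVT2'[of ?\<Psi> 1 0 0] 0 1 by auto
  moreover have "r \<noteq> 0" "r \<noteq> 1" using r(3) 0 1 by auto
  ultimately show ?thesis by (intro exI[of _ r]) auto
qed

text \<open>Both estimates for \<open>f\<close> increase with the modulus of the inner point, so the
  Schwarz bounds for \<open>\<omega> m z\<close> and \<open>\<omega> k z\<close> may be
  inserted.\<close>

lemma C_fun_le_Bohr_majorant:
  assumes k: "1 \<le> k" and m: "1 \<le> m" and p: "0 < p" and lam: "0 < lam"
    and f: "f \<in> \<B>" and a: "cmod (f 0) < 1"
    and \<omega>: "\<And>n. 1 \<le> n \<Longrightarrow> \<omega> n \<in> zero_order_class n" and z: "cmod z < 1"
  shows "C_fun p lam m k f \<omega> z \<le> Bohr_majorant p lam (cmod (f 0)) m k (cmod z)"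
proof -
  let ?a = "cmod (f 0)"
  have wm: "cmod (\<omega> m z) \<le> cmod z ^ m" and wk: "cmod (\<omega> k z) \<le> cmod z ^ k"
    using zero_order_class_norm_le \<omega> z k m by auto
  have lt: "cmod z ^ k < 1" "cmod z ^ m < 1" using z k m by (auto simp: power_less_one_iff)
  have "cmod (f (\<omega> m z)) \<le> (?a + cmod (\<omega> m z)) / (1 + ?a * cmod (\<omega> m z))"
    using wm lt by (intro Schwarz_Pick_bound f a) auto
  also have "\<dots> \<le> (?a + cmod z ^ m) / (1 + ?a * cmod z ^ m)"
    using a wm by (intro pseudohyperbolic_sum_mono) auto
  finally have "cmod (f (\<omega> m z)) powr p \<le> ((?a + cmod z ^ m) / (1 + ?a * cmod z ^ m)) powr p"
    using p by (intro powr_mono2) auto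
  moreover have "B1 f (cmod (\<omega> k z)) + A_term f (cmod (\<omega> k z)) \<le>
      (1 - ?a\<^sup>2) * (cmod (\<omega> k z) / (1 - cmod (\<omega> k z)))"
    using wk lt by (intro B1_A_term_le f) auto
  moreover have "(1 - ?a\<^sup>2) * (cmod (\<omega> k z) / (1 - cmod (\<omega> k z)))
      \<le> (1 - ?a\<^sup>2) * (cmod z ^ k / (1 - cmod z ^ k))"
    using a wk lt by (intro mult_left_mono divide_one_minus_mono) (auto simp: power_le_one)
  ultimately show ?thesis
    unfolding C_fun_def Bohr_majorant_def using lam
    by (intro add_mono mult_left_mono) auto
qed

section \<open>The extremal functions\<close>

lemma power_mem_zero_order_class: "(\<lambda>z. z ^ n) \<in> zero_order_class n"
proof -
  have "tcoeff (\<lambda>z. z ^ n) j = (if j = n then 1 else 0)" for j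
    by (subst fps_expansion_eqI[OF has_fps_expansion_fps_X_power]) (simp add: fps_X_power_nth)
  moreover have "(\<lambda>z. z ^ n) \<in> \<B>"
    by (auto simp: unit_disk_class_iff norm_power power_le_one intro!: holomorphic_intros)
  ultimately show ?thesis
    by (simp add: zero_order_class_def higher_deriv_eq_tcoeff)
qed

lemma extremal_mem_unit_disk_class:
  assumes "0 \<le> a" "a < 1"
  shows "(\<lambda>z. (z + of_real a) / (1 + of_real a * z)) \<in> \<B>"
proof -
  have nz: "1 + of_real a * z \<noteq> 0" if "cmod z < 1" for z :: complex
  proof
    assume "1 + of_real a * z = 0"
    hence "of_real a * z = -1" by (simp add: add_eq_0_iff)
    hence "a * cmod z = 1" using assms by (metis norm_minus_cancel norm_mult norm_of_real norm_one abs_of_nonneg)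
    moreover have "a * cmod z \<le> a * 1" using assms that by (intro mult_left_mono) auto
    ultimately show False using assms by simp
  qed
  have "cmod ((z + of_real a) / (1 + of_real a * z)) \<le> 1" if z: "cmod z < 1" for z
  proof -
    have "0 \<le> (1 - a\<^sup>2) * (1 - (cmod z)\<^sup>2)"
      using assms z by (intro mult_nonneg_nonneg) (auto simp: power_le_one)
    hence "(cmod (z + of_real a))\<^sup>2 \<le> (cmod (1 + of_real a * z))\<^sup>2"
      using Moebius_norm_identity[of "- of_real a" z]
      by (simp only: complex_cnj_minus complex_cnj_complex_of_real mult_minus_left
          diff_minus_eq_add norm_minus_cancel norm_of_real power2_abs)
    hence "cmod (z + of_real a) \<le> cmod (1 + of_real a * z)"
      by (rule power2_le_imp_le) (rule norm_ge_zero)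
    thus ?thesis using nz[OF z] by (simp add: norm_divide)
  qed
  thus ?thesis
    using nz by (auto simp: unit_disk_class_iff intro!: holomorphic_intros)
qed

text \<open>The function equals \<open>a\<close> + (1 - \<open>a\<^sup>2\<close>) z / (1 +
  \<open>a\<close> z), whose second term is a geometric series.\<close>

lemma tcoeff_extremal:
  assumes "0 \<le> a" "a < 1"
  shows "tcoeff (\<lambda>z. (z + of_real a) / (1 + of_real a * z)) (Suc n) =
    of_real (1 - a\<^sup>2) * (- of_real a) ^ n"
proof -
  define c where "c n = (if n = 0 then of_real a
    else of_real (1 - a\<^sup>2) * (- of_real a) ^ (n - 1) :: complex)" for n :: nat
  have "(\<lambda>n. c n * u ^ n) sums ((u + of_real a) / (1 + of_real a * u))" if u: "u \<in> ball 0 1" for u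
  proof -
    have "a * cmod u \<le> 1 * cmod u" using assms by (intro mult_right_mono) auto
    hence lt: "cmod (- of_real a * u) < 1" using u assms by (simp add: norm_mult)
    have "(\<lambda>n. of_real (1 - a\<^sup>2) * u * (- of_real a * u) ^ n) sums
        (of_real (1 - a\<^sup>2) * u * (1 / (1 - (- of_real a * u))))"
      by (intro sums_mult geometric_sums lt)
    moreover have "c (Suc n) * u ^ Suc n = of_real (1 - a\<^sup>2) * u * (- of_real a * u) ^ n" for n
      unfolding c_def power_mult_distrib by simp
    ultimately have "(\<lambda>n. c (Suc n) * u ^ Suc n) sums (of_real (1 - a\<^sup>2) * u * (1 / (1 + of_real a * u)))"
      by (simp only: mult_minus_left diff_minus_eq_add)
    hence "(\<lambda>n. c n * u ^ n) sums (of_real (1 - a\<^sup>2) * u * (1 / (1 + of_real a * u)) + c 0 * u ^ 0)"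
      by (subst (asm) sums_Suc_iff) simp
    moreover have "1 + of_real a * u \<noteq> 0"
      using lt by (auto simp: add_eq_0_iff)
    hence "of_real (1 - a\<^sup>2) * u * (1 / (1 + of_real a * u)) + c 0 * u ^ 0 =
        (u + of_real a) / (1 + of_real a * u)"
      by (simp add: c_def field_simps power2_eq_square)
    ultimately show ?thesis by simp
  qed
  hence "eventually (\<lambda>u. (\<lambda>n. fps_nth (Abs_fps c) n * u ^ n) sums
      ((u + of_real a) / (1 + of_real a * u))) (nhds 0)"
    using eventually_nhds_in_open[of "ball 0 1" "0::complex"] by (auto elim!: eventually_mono)
  hence "fps_expansion (\<lambda>z. (z + of_real a) / (1 + of_real a * z)) 0 = Abs_fps c"
    by (intro fps_expansion_eqI has_fps_expansionI)
  thus ?thesis by (simp add: c_def)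
qed

text \<open>At a real point \<open>r\<close> all estimates behind the majorant are equalities, as
  geometric sums confirm.\<close>

lemma C_fun_extremal:
  assumes "1 \<le> k" "0 \<le> a" "a < 1" "0 \<le> r" "r < 1"
  shows "C_fun p lam m k (\<lambda>z. (z + of_real a) / (1 + of_real a * z)) (\<lambda>n z. z ^ n) (of_real r)
    = Bohr_majorant p lam a m k r"
proof -
  let ?f = "\<lambda>z. (z + of_real a) / (1 + of_real a * z) :: complex"
  define \<rho> where "\<rho> = r ^ k"
  have \<rho>: "0 \<le> \<rho>" "\<rho> < 1" using assms by (auto simp: \<rho>_def power_less_one_iff)
  have a2: "a\<^sup>2 < 1" using assms by (simp add: power_less_one_iff)
  have a\<rho>: "0 \<le> a * \<rho>" "a * \<rho> < 1"
    using assms \<rho> mult_left_le[of \<rho> a] by auto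
  have coeff: "cmod (tcoeff ?f (Suc n)) = (1 - a\<^sup>2) * a ^ n" for n
    unfolding tcoeff_extremal[OF assms(2,3)] norm_mult norm_power norm_minus_cancel norm_of_real
    using a2 assms by simp
  have t0: "cmod (tcoeff ?f 0) = a" using assms by (simp add: tcoeff_0)
  have "(\<lambda>n. (1 - a\<^sup>2) * \<rho> * (a * \<rho>) ^ n) sums ((1 - a\<^sup>2) * \<rho> * (1 / (1 - a * \<rho>)))"
    using a\<rho> by (intro sums_mult geometric_sums) auto
  hence B: "B1 ?f \<rho> = (1 - a\<^sup>2) * \<rho> / (1 - a * \<rho>)"
    unfolding B1_def coeff by (simp add: sums_iff power_mult_distrib mult_ac)
  have "(\<lambda>n. ((1 - a\<^sup>2) * \<rho>)\<^sup>2 * ((a * \<rho>)\<^sup>2) ^ n) sums (((1 - a\<^sup>2) * \<rho>)\<^sup>2 * (1 / (1 - (a * \<rho>)\<^sup>2)))"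
    using a\<rho> by (intro sums_mult geometric_sums) (auto simp: power_less_one_iff)
  moreover have "((1 - a\<^sup>2) * \<rho>)\<^sup>2 * ((a * \<rho>)\<^sup>2) ^ n = ((1 - a\<^sup>2) * a ^ n)\<^sup>2 * \<rho> ^ (2 * Suc n)" for n
  proof -
    have "(a ^ n)\<^sup>2 = (a\<^sup>2) ^ n" by (simp add: power_mult[symmetric] mult.commute)
    moreover have "\<rho> ^ (2 * Suc n) = \<rho>\<^sup>2 * (\<rho>\<^sup>2) ^ n" by (simp only: power_mult power_Suc)
    ultimately show ?thesis by (simp only: power_mult_distrib mult_ac)
  qed
  ultimately have A: "A_term ?f \<rho> =
      (1 / (1 + a) + \<rho> / (1 - \<rho>)) * (((1 - a\<^sup>2) * \<rho>)\<^sup>2 / (1 - (a * \<rho>)\<^sup>2))"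
    unfolding A_term_def coeff t0 by (simp add: sums_iff)
  have "B1 ?f \<rho> + A_term ?f \<rho> = (1 - a\<^sup>2) * (\<rho> / (1 - \<rho>))"
  proof -
    have nz: "1 + a \<noteq> 0" "1 - \<rho> \<noteq> 0" "1 - a * \<rho> \<noteq> 0" "1 + a * \<rho> \<noteq> 0"
      using assms(2) \<rho>(2) a\<rho> by linarith+
    \<comment> \<open>The numerator \<open>1 + a * \<rho>\<close> cancels a factor of
      \<open>1 - (a * \<rho>)\<^sup>2\<close>, so \<open>A_term\<close> gets the denominator
      \<open>1 - a * \<rho>\<close> of \<open>B1\<close>.\<close>
    have "1 / (1 + a) + \<rho> / (1 - \<rho>) = (1 + a * \<rho>) / ((1 + a) * (1 - \<rho>))"
      using nz by (simp add: add_frac_eq) (simp add: algebra_simps)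
    moreover have "((1 - a\<^sup>2) * \<rho>)\<^sup>2 / (1 - (a * \<rho>)\<^sup>2) =
        ((1 - a\<^sup>2) * ((1 - a) * (1 + a)) * \<rho>\<^sup>2) / ((1 - a * \<rho>) * (1 + a * \<rho>))"
      by (intro arg_cong2[where f = "(/)"]) (simp_all add: power2_eq_square algebra_simps)
    ultimately have "A_term ?f \<rho> = (1 - a\<^sup>2) * (1 - a) * \<rho>\<^sup>2 / ((1 - \<rho>) * (1 - a * \<rho>))"
      unfolding A using nz by simp
    hence "B1 ?f \<rho> + A_term ?f \<rho> =
        (1 - a\<^sup>2) * (\<rho> / (1 - a * \<rho>) * (1 + (1 - a) * \<rho> / (1 - \<rho>)))"
      unfolding B by (simp add: distrib_left power2_eq_square mult_ac)
    also have "1 + (1 - a) * \<rho> / (1 - \<rho>) = (1 - a * \<rho>) / (1 - \<rho>)"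
      using nz by (simp add: field_simps)
    finally show ?thesis using nz by simp
  qed
  moreover have "cmod (?f (of_real r ^ m)) = (a + r ^ m) / (1 + a * r ^ m)"
  proof -
    have "?f (of_real r ^ m) = of_real ((a + r ^ m) / (1 + a * r ^ m))"
      by (simp add: add.commute)
    hence "cmod (?f (of_real r ^ m)) = \<bar>(a + r ^ m) / (1 + a * r ^ m)\<bar>"
      by (simp only: norm_of_real)
    thus ?thesis using assms by simp
  qed
  ultimately show ?thesis
    unfolding C_fun_def Bohr_majorant_def using assms
    by (simp add: norm_power \<rho>_def)
qed

section \<open>The radius and its sharpness\<close>

theorem theorem4:
  fixes k m :: nat and p lam a :: real
  assumes "1 \<le> k" and "1 \<le> m" and "0 < p" and "0 < lam" and "0 \<le> a" and "a < 1"
  shows "\<exists>R4. minimal_root_01 (Psi4 p lam a m k) R4 \<and>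
    (\<forall>f \<omega> z. f \<in> \<B> \<and> cmod (f 0) = a \<and> (\<forall>n\<ge>1. \<omega> n \<in> zero_order_class n) \<and> cmod z \<le> R4
        \<longrightarrow> C_fun p lam m k f \<omega> z \<le> 1) \<and>
    (\<forall>R. R4 < R \<and> R < 1 \<longrightarrow>
        (\<exists>f \<omega> z. f \<in> \<B> \<and> cmod (f 0) = a \<and> (\<forall>n\<ge>1. \<omega> n \<in> zero_order_class n) \<and> cmod z \<le> R
           \<and> C_fun p lam m k f \<omega> z > 1))"
proof -
  let ?\<Phi> = "Bohr_majorant p lam a m k"
  obtain R4 where R4: "0 < R4" "R4 < 1" "Psi4 p lam a m k R4 = 0"
    using Psi4_root_exists[OF assms] by blast
  have \<Phi>R4: "?\<Phi> R4 = 1" using R4 assms by (simp add: Psi4_eq_0_iff)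
  note mono = Bohr_majorant_strict_mono[OF assms(1,3-6), of _ _ m]
  have "minimal_root_01 (Psi4 p lam a m k) R4"
    unfolding minimal_root_01_def
  proof (intro conjI allI impI R4)
    fix r assume r: "0 < r \<and> r < 1 \<and> Psi4 p lam a m k r = 0"
    hence "?\<Phi> r = 1" using Psi4_eq_0_iff[of k a r] assms by simp
    thus "R4 \<le> r" using mono[of r R4] r R4 \<Phi>R4 by force
  qed
  moreover have "C_fun p lam m k f \<omega> z \<le> 1"
    if "f \<in> \<B> \<and> cmod (f 0) = a \<and> (\<forall>n\<ge>1. \<omega> n \<in> zero_order_class n) \<and> cmod z \<le> R4" for f \<omega> z
  proof -
    have "C_fun p lam m k f \<omega> z \<le> ?\<Phi> (cmod z)"
      using C_fun_le_Bohr_majorant[OF assms(1-4), of f \<omega> z] that R4 assms by auto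
    also have "\<dots> \<le> ?\<Phi> R4"
      using mono[of "cmod z" R4] that R4 by (cases "cmod z = R4") auto
    finally show ?thesis by (simp add: \<Phi>R4)
  qed
  moreover have "\<exists>f \<omega> z. f \<in> \<B> \<and> cmod (f 0) = a \<and> (\<forall>n\<ge>1. \<omega> n \<in> zero_order_class n) \<and>
      cmod z \<le> R \<and> C_fun p lam m k f \<omega> z > 1" if R: "R4 < R \<and> R < 1" for R
  proof -
    \<comment> \<open>The point z = \<open>R\<close> itself is the witness, since there
      \<open>C_fun\<close> of the extremal functions equals the majorant.\<close>
    have "1 < ?\<Phi> R" using mono[of R4 R] R R4 \<Phi>R4 by simp
    thus ?thesis
      using R R4 assms C_fun_extremal[of k a R p lam m] extremal_mem_unit_disk_class[of a]
        power_mem_zero_order_class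
      by (intro exI[of _ "\<lambda>z. (z + of_real a) / (1 + of_real a * z)"] exI[of _ "\<lambda>n z. z ^ n"]
          exI[of _ "of_real R"]) auto
  qed
  ultimately show ?thesis by blast
qed

end
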